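(* Let $d\mu=d\mu_{\rm ac}=f\,dx$ with $0\leq f\in L^1_{\rm loc}(\mathbb{R};dx)$ be an absolutely continuous measure on $\mathbb{R}$. If $S$ is any essential support of $d\mu$, then $$\overline{S}^{e}=\overline{\{x\in\mathbb{R} : f(x)>0\}}^{e}=\mathrm{supp}\,(d\mu).$$
   Context: $|\cdot|$ denotes Lebesgue measure on $\mathbb{R}$; all sets whose $\mu$-measure or Lebesgue measure is considered are assumed to be measurable with respect to the corresponding completed measure. Essential support: a measurable set $S\subseteq\mathbb{R}$ is an essential support of $d\mu$ (relative to Lebesgue measure) if $\mu(\mathbb{R}\setminus S)=0$, and $S'\subseteq S$ Lebesgue measurable with $\mu(S')=0$ implies $|S'|=0$. Topological support: $\mathrm{supp}\,(d\mu)$ is the smallest closed set $F\subseteq\mathbb{R}$ with $\mu(\mathbb{R}\setminus F)=0$. Essential closure: for Lebesgue measurable $A\subseteq\mathbb{R}$, $\overline{A}^{e}=\{x\in\mathbb{R} : |(x-\varepsilon,x+\varepsilon)\cap A|>0 \text{ for all } \varepsilon>0\}$. *)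

theory Defs
  imports "HOL-Analysis.Analysis"
begin

definition locally_integrable :: "(real \<Rightarrow> real) \<Rightarrow> bool"
  where "locally_integrable f \<longleftrightarrow>
    f \<in> borel_measurable lebesgue \<and> (\<forall>K. compact K \<longrightarrow> set_integrable lebesgue K f)"

text \<open>Sets are required to be measurable with respect to both the Lebesgue measure and the
  completion of \<open>\<mu>\<close>; membership in \<open>null_sets\<close> includes measurability.\<close>

definition essential_support :: "real measure \<Rightarrow> real set \<Rightarrow> bool"
  where "essential_support \<mu> S \<longleftrightarrow>
    S \<in> sets lebesgue \<and>
    UNIV - S \<in> null_sets (completion \<mu>) \<and>
    (\<forall>S'. S' \<subseteq> S \<and> S' \<in> sets lebesgue \<and> S' \<in> null_sets (completion \<mu>)
      \<longrightarrow> emeasure lebesgue S' = 0)"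

text \<open>\<open>LEAST\<close> is with respect to set inclusion, so the value is unspecified unless
  a smallest such closed set exists.\<close>

definition topological_support :: "real measure \<Rightarrow> real set"
  where "topological_support \<mu> = (LEAST F. closed F \<and> UNIV - F \<in> null_sets \<mu>)"

text \<open>Meaningful only for Lebesgue measurable \<open>A\<close>: \<open>emeasure\<close> is 0 on non-measurable sets.\<close>

definition essential_closure :: "real set \<Rightarrow> real set"
  where "essential_closure A =
    {x. \<forall>\<epsilon>>0. emeasure lebesgue ({x - \<epsilon><..<x + \<epsilon>} \<inter> A) > 0}"

end

theory Submission
  imports Defs
begin

text \<open>Write \<open>P = {x. f x > 0}\<close>. Everything rests on one observation: a Lebesgue measurable set
  is \<open>\<mu>\<close>-null precisely when it meets \<open>P\<close> in a Lebesgue null set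
  (\<open>null_sets_density_iff_positive_part\<close>), so that only Lebesgue null sets and \<open>P\<close> matter.

  For the first equality, an essential support \<open>S\<close> agrees with \<open>P\<close> up to a Lebesgue null set:
  the complement of \<open>S\<close> is \<open>\<mu>\<close>-null, hence \<open>P - S\<close> is Lebesgue null, and \<open>S - P\<close> is a \<open>\<mu>\<close>-null
  subset of \<open>S\<close>, hence Lebesgue null by minimality. The essential closure is insensitive to null
  sets.

  For the second equality, the complement of the essential closure of \<open>P\<close> is the union of all
  open sets that meet \<open>P\<close> in a Lebesgue null set, which are the \<open>\<mu>\<close>-null open sets. As the line
  is a Lindelof space, this union is itself one of those sets, and it is the largest. Its
  complement is therefore the smallest closed set of full \<open>\<mu>\<close>-measure.\<close>

lemma null_sets_density_iff_positive_part:
  fixes f :: "'a \<Rightarrow> real"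
  assumes f: "f \<in> borel_measurable M" and A: "A \<in> sets M"
  shows "A \<in> null_sets (density M (\<lambda>x. ennreal (f x))) \<longleftrightarrow> A \<inter> {x. f x > 0} \<in> null_sets M"
proof -
  have eq: "A \<inter> {x. f x > 0} = {x \<in> space M. \<not> (x \<in> A \<longrightarrow> f x \<le> 0)}"
    using sets.sets_into_space[OF A] by (auto simp: not_le)
  have meas: "{x \<in> space M. \<not> (x \<in> A \<longrightarrow> f x \<le> 0)} \<in> sets M"
    using f A by measurable
  have "A \<in> null_sets (density M (\<lambda>x. ennreal (f x))) \<longleftrightarrow> (AE x in M. x \<in> A \<longrightarrow> f x \<le> 0)"
    using f A by (simp add: null_sets_density_iff ennreal_eq_0_iff)
  also have "\<dots> \<longleftrightarrow> A \<inter> {x. f x > 0} \<in> null_sets M"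
    unfolding eq using meas by (rule AE_iff_null)
  finally show ?thesis .
qed

lemma essential_closure_cong_null_sets:
  assumes AB: "A - B \<in> null_sets lebesgue" and BA: "B - A \<in> null_sets lebesgue"
    and A: "A \<in> sets lebesgue" and B: "B \<in> sets lebesgue"
  shows "essential_closure A = essential_closure B"
proof -
  have "emeasure lebesgue ({x - \<epsilon><..<x + \<epsilon>} \<inter> A) = emeasure lebesgue ({x - \<epsilon><..<x + \<epsilon>} \<inter> B)"
    for x \<epsilon> :: real
  proof (rule emeasure_eq_AE)
    show "AE y in lebesgue. y \<in> {x - \<epsilon><..<x + \<epsilon>} \<inter> A \<longleftrightarrow> y \<in> {x - \<epsilon><..<x + \<epsilon>} \<inter> B"
      using AE_not_in[OF AB] AE_not_in[OF BA] by eventually_elim auto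
  qed (use A B in auto)
  then show ?thesis
    by (simp add: essential_closure_def)
qed

text \<open>Trading symmetric intervals for arbitrary open neighbourhoods describes the complement
  without reference to points, which makes the countable covering argument applicable.\<close>

lemma Compl_essential_closure:
  assumes A: "A \<in> sets lebesgue"
  shows "- essential_closure A = \<Union>{U. open U \<and> U \<inter> A \<in> null_sets lebesgue}"
proof (intro set_eqI iffI)
  fix x
  assume "x \<in> - essential_closure A"
  then obtain \<epsilon> where "\<epsilon> > 0" "emeasure lebesgue ({x - \<epsilon><..<x + \<epsilon>} \<inter> A) = 0"
    by (auto simp: essential_closure_def zero_less_iff_neq_zero)
  with A have "x \<in> {x - \<epsilon><..<x + \<epsilon>}" "{x - \<epsilon><..<x + \<epsilon>} \<inter> A \<in> null_sets lebesgue"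
    by (simp_all add: null_setsI sets.Int)
  then show "x \<in> \<Union>{U. open U \<and> U \<inter> A \<in> null_sets lebesgue}"
    by (intro UnionI[of "{x - \<epsilon><..<x + \<epsilon>}"]) simp_all
next
  fix x
  assume "x \<in> \<Union>{U. open U \<and> U \<inter> A \<in> null_sets lebesgue}"
  then obtain U where U: "open U" "x \<in> U" "U \<inter> A \<in> null_sets lebesgue"
    by blast
  then obtain \<epsilon> where "\<epsilon> > 0" and "ball x \<epsilon> \<subseteq> U"
    by (meson openE)
  then have "{x - \<epsilon><..<x + \<epsilon>} \<inter> A \<subseteq> U \<inter> A"
    by (auto simp: ball_eq_greaterThanLessThan)
  then have "{x - \<epsilon><..<x + \<epsilon>} \<inter> A \<in> null_sets lebesgue"
    using A by (intro null_sets_subset[OF U(3)]) auto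
  with \<open>\<epsilon> > 0\<close> show "x \<in> - essential_closure A"
    by (auto simp: essential_closure_def dest!: null_setsD1)
qed

lemma closed_essential_closure:
  assumes "A \<in> sets lebesgue"
  shows "closed (essential_closure A)"
  unfolding closed_def Compl_essential_closure[OF assms] by blast

text \<open>The union in \<open>Compl_essential_closure\<close> is uncountable, but by the Lindelof property
  countably many of its members already cover it.\<close>

lemma null_sets_Compl_essential_closure_Int:
  assumes A: "A \<in> sets lebesgue"
  shows "- essential_closure A \<inter> A \<in> null_sets lebesgue"
proof -
  define \<U> where "\<U> = {U. open U \<and> U \<inter> A \<in> null_sets lebesgue}"
  obtain \<V> where \<V>: "\<V> \<subseteq> \<U>" "countable \<V>" "\<Union>\<V> = \<Union>\<U>"
    by (rule Lindelof[of \<U>]) (auto simp: \<U>_def)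
  have "(\<Union>U\<in>\<V>. U \<inter> A) \<in> null_sets lebesgue"
    using \<V> by (intro null_sets_UN') (auto simp: \<U>_def)
  moreover have "- essential_closure A \<inter> A = (\<Union>U\<in>\<V>. U \<inter> A)"
    using Compl_essential_closure[OF A] \<V>(3) by (auto simp: \<U>_def)
  ultimately show ?thesis
    by simp
qed

lemma topological_support_density:
  fixes f :: "real \<Rightarrow> real"
  assumes f: "f \<in> borel_measurable lebesgue"
  shows "topological_support (density lebesgue (\<lambda>x. ennreal (f x)))
    = essential_closure {x. f x > 0}"
proof -
  let ?P = "{x. f x > 0}"
  have P: "?P \<in> sets lebesgue"
    using borel_measurable_less[OF borel_measurable_const f] by simp
  have null: "UNIV - F \<in> null_sets (density lebesgue (\<lambda>x. ennreal (f x)))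
      \<longleftrightarrow> - F \<inter> ?P \<in> null_sets lebesgue" if "closed F" for F
    using null_sets_density_iff_positive_part[OF f, of "- F"] that
    by (simp add: Compl_eq_Diff_UNIV[symmetric] borel_open)
  show ?thesis
    unfolding topological_support_def
  proof (rule Least_equality)
    show "closed (essential_closure ?P) \<and>
        UNIV - essential_closure ?P \<in> null_sets (density lebesgue (\<lambda>x. ennreal (f x)))"
      using closed_essential_closure[OF P] null_sets_Compl_essential_closure_Int[OF P]
      by (simp add: null)
  next
    fix F
    assume F: "closed F \<and> UNIV - F \<in> null_sets (density lebesgue (\<lambda>x. ennreal (f x)))"
    then have "- F \<subseteq> - essential_closure ?P"
      unfolding Compl_essential_closure[OF P] using null by blast
    then show "essential_closure ?P \<subseteq> F"
      by blast
  qed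
qed

theorem lemma2p10:
  fixes f :: "real \<Rightarrow> real" and \<mu> :: "real measure" and S :: "real set"
  assumes "locally_integrable f"
    and "AE x in lebesgue. 0 \<le> f x"
    and "\<mu> = density lebesgue (\<lambda>x. ennreal (f x))"
    and "essential_support \<mu> S"
  shows "essential_closure S = essential_closure {x. f x > 0} \<and>
    essential_closure {x. f x > 0} = topological_support \<mu>"
proof -
  let ?P = "{x. f x > 0}"
  have f: "f \<in> borel_measurable lebesgue"
    using assms(1) by (simp add: locally_integrable_def)
  have P: "?P \<in> sets lebesgue"
    using borel_measurable_less[OF borel_measurable_const f] by simp
  have S: "S \<in> sets lebesgue"
    using assms(4) by (simp add: essential_support_def)
  \<comment> \<open>The completion of \<open>\<mu>\<close> has more measurable sets, but no new null sets among the Lebesgue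
    measurable ones.\<close>
  have null: "A \<in> null_sets (completion \<mu>) \<longleftrightarrow> A \<inter> ?P \<in> null_sets lebesgue"
    if "A \<in> sets lebesgue" for A
    using null_sets_density_iff_positive_part[OF f that] that
    by (simp add: assms(3) null_sets_completion_iff)
  have "UNIV - S \<in> null_sets (completion \<mu>)"
    using assms(4) by (simp add: essential_support_def)
  moreover have "(UNIV - S) \<inter> ?P = ?P - S"
    by blast
  ultimately have PS: "?P - S \<in> null_sets lebesgue"
    using null[OF sets.Diff[OF _ S, of UNIV]] by simp
  have "S - ?P \<in> null_sets (completion \<mu>)"
    using S P by (subst null) (auto simp: Int_Diff Diff_Int_distrib2)
  then have "emeasure lebesgue (S - ?P) = 0"
    using assms(4) S P by (auto simp: essential_support_def)
  then have SP: "S - ?P \<in> null_sets lebesgue"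
    using S P by auto
  show ?thesis
    using essential_closure_cong_null_sets[OF SP PS S P] topological_support_density[OF f] assms(3)
    by simp
qed

end
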